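(* For $t\ge0$ define $$f(t):=\sum_{i=0}^{\lfloor t\rfloor}\frac{(i-t)^ie^{t-i}}{i!}.$$ For all $t>0$, $$f(t)=2t+\frac23+\sum_{\substack{\gamma\in\mathbb C:\ \gamma\ne0,\\ \gamma=1-\exp(-\gamma)}}\frac1\gamma e^{\gamma t}.$$ The sum is absolutely convergent, uniformly for $t$ in $(\varepsilon,\infty)$ for any $\varepsilon>0$.
   Context: The convention $0^0=1$ is used. The function $f$ is the renewal function of the uniform renewal process: $f(t)=\mathbb E[N(t)]$, where $N(t)=\min\{i\ge0:\chi_1+\dots+\chi_i>t\}$ with $\chi_1,\chi_2,\dots$ i.i.d. uniform on $(0,1)$. *)

theory Defs
  imports "HOL-Complex_Analysis.Complex_Analysis"
begin

text \<open>
  The intended domain is \<open>t \<ge> 0\<close>; the value at negative \<open>t\<close> is irrelevant.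
  The convention \<open>0 ^ 0 = 1\<close> is that of HOL's power on a natural exponent.
\<close>

definition renewal_fun :: "real \<Rightarrow> real" where
  "renewal_fun t = (\<Sum>i = 0..nat \<lfloor>t\<rfloor>. (real i - t) ^ i * exp (t - real i) / fact i)"

definition char_roots :: "complex set" where
  "char_roots = {\<gamma>. \<gamma> \<noteq> 0 \<and> \<gamma> = 1 - exp (- \<gamma>)}"

end

theory Submission
  imports Defs "HOL-Real_Asymp.Real_Asymp"
begin

text \<open>
  The Laplace transform of the renewal function is \<open>1 / D(s)\<close> with \<open>D(s) = s - 1 + exp (- s)\<close>.
  Truncating the geometric expansion of \<open>1 / D(s)\<close> in powers of \<open>exp (- s) / (s - 1)\<close> after
  \<open>n = \<lfloor>t\<rfloor>\<close> gives
  \[ \frac{e^{st}}{D(s)} = \sum_{i \le n} \frac{(-1)^i e^{(t-i)s}}{(s-1)^{i+1}}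
       + \frac{(-1)^{n+1} e^{(t-n-1)s}}{(s-1)^{n+1} D(s)}. \]
  Integrate this over the segment from \<open>2 - iy\<close> to \<open>2 + iy\<close> and let \<open>y\<close> tend to infinity.
  Closing the contour to the left, the \<open>i\<close>-th term contributes its residue at \<open>1\<close>, which is the
  \<open>i\<close>-th term of the renewal function; closing it to the right, the remainder contributes nothing.
  On the other hand, closing the contour for the whole of \<open>exp (s t) / D(s)\<close> to the left collects the
  residue \<open>2 t + 2 / 3\<close> at the double pole \<open>0\<close> and \<open>exp (\<gamma> t) / \<gamma>\<close> at every characteristic root.
  The heights \<open>y\<close> are chosen with \<open>sin y = - 1\<close>, so that the imaginary parts of \<open>s\<close> and \<open>exp (- s)\<close>
  have the same sign on the horizontal edges, and the left edge is at \<open>- ln (4 y)\<close>, where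
  \<open>exp (- s)\<close> dominates \<open>s - 1\<close>.

  The sum converges absolutely because \<open>|exp (\<gamma> t)| = |1 - \<gamma>| powr (- t)\<close> and the roots are
  separated: \<open>\<gamma> + Ln (1 - \<gamma>)\<close> is an integer multiple of \<open>2 \<pi> i\<close>, and this multiple determines
  \<open>\<gamma>\<close> since \<open>z \<mapsto> Ln (1 - z)\<close> is a strict contraction on the left half-plane.
\<close>

section \<open>Characteristic roots\<close>

lemma char_roots_exp_minus:
  assumes "\<gamma> \<in> char_roots"
  shows "exp (- \<gamma>) = 1 - \<gamma>"
proof -
  have "\<gamma> = 1 - exp (- \<gamma>)" using assms unfolding char_roots_def by blast
  from arg_cong[OF this, of "\<lambda>z. 1 - z"] show ?thesis by simp
qed

text \<open>If \<open>Re \<gamma> > 0\<close>, then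
  \<open>|Im \<gamma>| = exp (- Re \<gamma>) * |sin (Im \<gamma>)|\<close> forces
  \<open>Im \<gamma> = 0\<close>; if \<open>Re \<gamma> = 0\<close>, the real part of the equation
  gives \<open>cos (Im \<gamma>) = 1\<close>, with the same outcome. The real equation
  \<open>x = 1 - exp (- x)\<close> has only the solution 0.\<close>

lemma char_roots_Re_neg:
  assumes "\<gamma> \<in> char_roots"
  shows "Re \<gamma> < 0"
proof (rule ccontr)
  assume "\<not> Re \<gamma> < 0"
  then have a: "Re \<gamma> \<ge> 0" by simp
  have eq: "\<gamma> = 1 - exp (- \<gamma>)" and nz: "\<gamma> \<noteq> 0"
    using assms unfolding char_roots_def by blast+
  have im: "Im \<gamma> = exp (- Re \<gamma>) * sin (Im \<gamma>)"
    using arg_cong[OF eq, of Im] by (simp add: Im_exp)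
  have re: "Re \<gamma> = 1 - exp (- Re \<gamma>) * cos (Im \<gamma>)"
    using arg_cong[OF eq, of Re] by (simp add: Re_exp)
  have b: "Im \<gamma> = 0"
  proof (cases "Re \<gamma> = 0")
    case True
    then have "cos (Im \<gamma>) = 1" using re by simp
    then have "sin (Im \<gamma>) = 0" by (metis cos_one_sin_zero)
    then show ?thesis using im by simp
  next
    case False
    have abs: "\<bar>Im \<gamma>\<bar> = exp (- Re \<gamma>) * \<bar>sin (Im \<gamma>)\<bar>"
      using arg_cong[OF im, of abs] by (simp add: abs_mult)
    also have "\<dots> \<le> exp (- Re \<gamma>) * \<bar>Im \<gamma>\<bar>"
      by (intro mult_left_mono abs_sin_x_le_abs_x) simp
    finally have "(1 - exp (- Re \<gamma>)) * \<bar>Im \<gamma>\<bar> \<le> 0" by (simp add: algebra_simps)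
    moreover have "1 - exp (- Re \<gamma>) > 0" using a False by simp
    ultimately show ?thesis by (simp add: mult_le_0_iff)
  qed
  have "Re \<gamma> = 1 - exp (- Re \<gamma>)"
    using re b by simp
  then have "Re \<gamma> = 0"
    using exp_minus_greater[of "Re \<gamma>"] by auto
  with b nz show False by (simp add: complex_eq_iff)
qed

text \<open>Exponential decay in \<open>Re \<gamma>\<close> becomes polynomial decay in
  \<open>\<gamma>\<close>, because \<open>exp (- \<gamma>) = 1 - \<gamma>\<close>. Together with the
  factor \<open>1 / \<gamma>\<close> this yields the summable exponent
  \<open>- 1 - t\<close>.\<close>

lemma norm_exp_char_root:
  assumes "\<gamma> \<in> char_roots"
  shows "norm (exp (\<gamma> * of_real t)) = norm (1 - \<gamma>) powr (- t)"
proof -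
  have "norm (1 - \<gamma>) = exp (- Re \<gamma>)"
    by (metis char_roots_exp_minus[OF assms] norm_exp_eq_Re uminus_complex.sel(1))
  then show ?thesis by (simp add: powr_def)
qed

section \<open>Separation of the roots and absolute convergence of the root sum\<close>

text \<open>The derivative \<open>- 1 / (1 - x)\<close> has norm at most
  \<open>1 / (1 - r) < 1\<close> on the convex half-plane \<open>Re x \<le> r\<close>, where
  \<open>r < 0\<close> is the larger of the two real parts.\<close>

lemma Ln_one_minus_contraction:
  assumes "Re z < 0" "Re w < 0" "Ln (1 - z) - Ln (1 - w) = w - z"
  shows "z = w"
proof (rule ccontr)
  assume "z \<noteq> w"
  define r where "r = max (Re z) (Re w)"
  have r: "r < 0" using assms by (auto simp: r_def)
  have "norm (Ln (1 - z) - Ln (1 - w)) \<le> 1 / (1 - r) * norm (z - w)"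
  proof (rule field_differentiable_bound[where S = "{x. Re x \<le> r}" and f' = "\<lambda>x. - 1 / (1 - x)"])
    show "convex {x. Re x \<le> r}" by (rule convex_halfspace_Re_le)
    fix x assume "x \<in> {x. Re x \<le> r}"
    then have x: "Re x \<le> r" by simp
    then have "1 - x \<notin> \<real>\<^sub>\<le>\<^sub>0" using r by (auto simp: complex_nonpos_Reals_iff)
    then show "((\<lambda>x. Ln (1 - x)) has_field_derivative - 1 / (1 - x)) (at x within {x. Re x \<le> r})"
      by (auto intro!: derivative_eq_intros simp: field_simps)
    have "1 - r \<le> norm (1 - x)" using x complex_Re_le_cmod[of "1 - x"] by simp
    then show "norm (- 1 / (1 - x)) \<le> 1 / (1 - r)"
      using r by (simp add: norm_divide frac_le)
  qed (auto simp: r_def)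
  moreover have "norm (w - z) = norm (z - w)" by (rule norm_minus_commute)
  moreover have "1 / (1 - r) * norm (z - w) < norm (z - w)"
    using r \<open>z \<noteq> w\<close> by (simp add: field_simps mult_neg_pos)
  ultimately show False using assms(3) by simp
qed

text \<open>Majorant for the root sum. The index 0 does no harm, since
  \<open>0 powr a = 0\<close>.\<close>

lemma summable_on_int_powr:
  fixes a :: real
  assumes "a < -1"
  shows "(\<lambda>m::int. \<bar>of_int m\<bar> powr a) summable_on UNIV"
proof -
  let ?g = "\<lambda>m::int. \<bar>of_int m\<bar> powr a"
  have "summable (\<lambda>n. real n powr a)" using assms by (simp add: summable_real_powr_iff)
  then have s: "(\<lambda>n. real n powr a) summable_on UNIV"
    by (intro norm_summable_imp_summable_on) simp
  have 1: "?g summable_on range int"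
    using s by (subst summable_on_reindex) (auto simp: o_def)
  have 2: "?g summable_on range (\<lambda>n. - int n)"
    using s by (subst summable_on_reindex) (auto simp: o_def inj_on_def)
  have "?g summable_on (range int \<union> (range (\<lambda>n. - int n) - range int))"
    using 2 by (intro summable_on_Un_disjoint 1 summable_on_subset_banach[OF 2]) auto
  moreover have "range int \<union> (range (\<lambda>n. - int n) - range int) = UNIV"
    by (auto intro: int_cases2)
  ultimately show ?thesis by simp
qed

text \<open>The index is the branch number in
  \<open>\<gamma> + Ln (1 - \<gamma>) = 2 pi i m\<close>. Since
  \<open>|Im (Ln (1 - \<gamma>))| \<le> pi\<close>, one has
  \<open>2 pi |m| \<le> |Im \<gamma>| + pi\<close>; for \<open>m \<noteq> 0\<close> half of the left
  side absorbs the extra \<open>pi\<close>.\<close>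

lemma char_roots_indexing:
  obtains m :: "complex \<Rightarrow> int"
  where "inj_on m char_roots" "\<And>\<gamma>. \<gamma> \<in> char_roots \<Longrightarrow> \<bar>of_int (m \<gamma>)\<bar> \<le> \<bar>Im \<gamma>\<bar>"
proof -
  have "\<exists>m. \<gamma> + Ln (1 - \<gamma>) = of_int (2 * m) * (of_real pi * \<i>)" if "\<gamma> \<in> char_roots" for \<gamma>
  proof -
    have "exp (- \<gamma>) = 1 - \<gamma>" "1 - \<gamma> \<noteq> 0"
      using char_roots_exp_minus[OF that] char_roots_Re_neg[OF that] by auto
    then have "exp (Ln (1 - \<gamma>)) = exp (- \<gamma>)" by simp
    then obtain n :: int where "Ln (1 - \<gamma>) = - \<gamma> + (of_int (2 * n) * pi) * \<i>"
      unfolding exp_eq by auto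
    then show ?thesis by (intro exI[of _ n]) (simp add: algebra_simps)
  qed
  then obtain m where m: "\<And>\<gamma>. \<gamma> \<in> char_roots \<Longrightarrow> \<gamma> + Ln (1 - \<gamma>) = of_int (2 * m \<gamma>) * (of_real pi * \<i>)"
    by metis
  have "inj_on m char_roots"
  proof (rule inj_onI)
    fix z w assume zw: "z \<in> char_roots" "w \<in> char_roots" "m z = m w"
    then have "z + Ln (1 - z) = w + Ln (1 - w)" using m by simp
    then have "Ln (1 - z) - Ln (1 - w) = w - z" by (simp add: algebra_simps)
    then show "z = w" using zw by (metis Ln_one_minus_contraction char_roots_Re_neg)
  qed
  moreover have "\<bar>of_int (m \<gamma>)\<bar> \<le> \<bar>Im \<gamma>\<bar>" if "\<gamma> \<in> char_roots" for \<gamma>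
  proof (cases "m \<gamma> = 0")
    case False
    have "1 - \<gamma> \<noteq> 0" using char_roots_Re_neg[OF that] by auto
    then have "\<bar>Im (Ln (1 - \<gamma>))\<bar> \<le> pi"
      using mpi_less_Im_Ln[of "1 - \<gamma>"] Im_Ln_le_pi[of "1 - \<gamma>"] by simp
    moreover have "Im \<gamma> + Im (Ln (1 - \<gamma>)) = 2 * pi * of_int (m \<gamma>)"
      using arg_cong[OF m[OF that], of Im] by simp
    ultimately have "\<bar>2 * pi * of_int (m \<gamma>)\<bar> \<le> \<bar>Im \<gamma>\<bar> + pi" by linarith
    then have "2 * pi * \<bar>of_int (m \<gamma>)\<bar> \<le> \<bar>Im \<gamma>\<bar> + pi" by (simp add: abs_mult)
    moreover have 1: "1 \<le> \<bar>of_int (m \<gamma>) :: real\<bar>" using False by linarith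
    then have "pi * 1 \<le> pi * \<bar>of_int (m \<gamma>)\<bar>" by (intro mult_left_mono) auto
    moreover have "1 * \<bar>of_int (m \<gamma>)\<bar> \<le> pi * \<bar>of_int (m \<gamma>)\<bar>"
      using pi_ge_two by (intro mult_right_mono) auto
    ultimately show ?thesis by linarith
  qed auto
  ultimately show ?thesis using that by blast
qed

lemma char_roots_summable:
  assumes "t > 0"
  shows "(\<lambda>\<gamma>. norm (1 / \<gamma> * exp (\<gamma> * complex_of_real t))) summable_on char_roots"
proof -
  let ?h = "\<lambda>\<gamma>. norm (1 / \<gamma> * exp (\<gamma> * complex_of_real t))"
  obtain m :: "complex \<Rightarrow> int" where inj: "inj_on m char_roots"
    and m: "\<And>\<gamma>. \<gamma> \<in> char_roots \<Longrightarrow> \<bar>of_int (m \<gamma>)\<bar> \<le> \<bar>Im \<gamma>\<bar>"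
    using char_roots_indexing by blast
  \<comment> \<open>At index 0 the lower bound on \<open>|Im \<gamma>|\<close> is void, so such
    roots are set aside; injectivity of \<open>m\<close> makes them finite in number.\<close>
  define A where "A = {\<gamma> \<in> char_roots. m \<gamma> \<noteq> 0}"
  define Z where "Z = {\<gamma> \<in> char_roots. m \<gamma> = 0}"
  have "(\<lambda>i::int. \<bar>of_int i\<bar> powr (- 1 - t)) summable_on m ` A"
    by (rule summable_on_subset_banach[OF summable_on_int_powr]) (use assms in auto)
  moreover have "inj_on m A" using inj by (auto simp: A_def inj_on_def)
  ultimately have "(\<lambda>\<gamma>. \<bar>of_int (m \<gamma>)\<bar> powr (- 1 - t)) summable_on A"
    by (simp add: summable_on_reindex o_def)
  then have "?h summable_on A"
  proof (rule summable_on_comparison_test)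
    fix \<gamma> assume "\<gamma> \<in> A"
    then have g: "\<gamma> \<in> char_roots" and nz: "m \<gamma> \<noteq> 0" by (auto simp: A_def)
    define r where "r = \<bar>real_of_int (m \<gamma>)\<bar>"
    have r: "r > 0" using nz by (simp add: r_def)
    have 1: "r \<le> norm \<gamma>" "r \<le> norm (1 - \<gamma>)"
      using m[OF g] abs_Im_le_cmod[of \<gamma>] abs_Im_le_cmod[of "1 - \<gamma>"] by (auto simp: r_def)
    have "?h \<gamma> = inverse (norm \<gamma>) * norm (1 - \<gamma>) powr (- t)"
      by (simp add: norm_mult norm_divide divide_inverse norm_inverse norm_exp_char_root[OF g] del: norm_exp_eq_Re)
    also have "\<dots> \<le> inverse r * r powr (- t)"
      using 1 r assms by (intro mult_mono powr_mono2' le_imp_inverse_le) auto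
    also have "\<dots> = r powr (- 1 - t)"
      using r by (simp add: powr_diff powr_minus divide_inverse)
    finally show "?h \<gamma> \<le> \<bar>of_int (m \<gamma>)\<bar> powr (- 1 - t)" by (simp add: r_def)
  qed auto
  moreover have "finite (m ` Z)" by (rule finite_subset[of _ "{0}"]) (auto simp: Z_def)
  then have "finite Z"
    by (rule finite_imageD) (use inj in \<open>auto simp: Z_def inj_on_def\<close>)
  then have "?h summable_on Z" by simp
  ultimately have "?h summable_on (A \<union> Z)"
    by (intro summable_on_Un_disjoint) (auto simp: A_def Z_def)
  moreover have "A \<union> Z = char_roots" by (auto simp: A_def Z_def)
  ultimately show ?thesis by simp
qed

text \<open>Since \<open>Re \<gamma> < 0\<close>, every term decreases in \<open>t\<close>, so its
  value at \<open>\<epsilon>\<close> serves as majorant in the Weierstrass test.\<close>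

lemma char_roots_uniform_limit:
  assumes "\<epsilon> > 0"
  shows "uniform_limit {\<epsilon><..}
           (\<lambda>F t. \<Sum>\<gamma>\<in>F. norm (1 / \<gamma> * exp (\<gamma> * complex_of_real t)))
           (\<lambda>t. \<Sum>\<^sub>\<infinity>\<gamma>\<in>char_roots. norm (1 / \<gamma> * exp (\<gamma> * complex_of_real t)))
           (finite_subsets_at_top char_roots)"
proof (rule Weierstrass_m_test_general[OF _ char_roots_summable[OF assms]])
  fix \<gamma> and t :: real assume "\<gamma> \<in> char_roots" "t \<in> {\<epsilon><..}"
  then have "Re \<gamma> * t \<le> Re \<gamma> * \<epsilon>"
    using char_roots_Re_neg[of \<gamma>] by (intro mult_left_mono_neg) auto
  then show "norm (norm (1 / \<gamma> * exp (\<gamma> * complex_of_real t)))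
      \<le> norm (1 / \<gamma> * exp (\<gamma> * complex_of_real \<epsilon>))"
    by (simp add: norm_mult norm_divide divide_right_mono)
qed

section \<open>Contour integrals over rectangles\<close>

lemma contour_integral_rectpath:
  assumes "continuous_on (path_image (rectpath a b)) h"
  shows "contour_integral (rectpath a b) h =
    contour_integral (linepath a (Complex (Re b) (Im a))) h +
    contour_integral (linepath (Complex (Re b) (Im a)) b) h +
    contour_integral (linepath b (Complex (Re a) (Im b))) h +
    contour_integral (linepath (Complex (Re a) (Im b)) a) h"
proof -
  define a2 a4 where "a2 = Complex (Re b) (Im a)" and "a4 = Complex (Re a) (Im b)"
  have path: "path_image (rectpath a b) =
    closed_segment a a2 \<union> closed_segment a2 b \<union> closed_segment b a4 \<union> closed_segment a4 a"
    by (simp add: rectpath_def Let_def path_image_join a2_def a4_def Un_assoc)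
  have "h contour_integrable_on linepath p q"
    if "closed_segment p q \<subseteq> path_image (rectpath a b)" for p q
    using that assms by (intro contour_integrable_continuous_linepath) (rule continuous_on_subset)
  then have "h contour_integrable_on linepath a a2" "h contour_integrable_on linepath a2 b"
    "h contour_integrable_on linepath b a4" "h contour_integrable_on linepath a4 a"
    unfolding path by auto
  then show ?thesis
    unfolding rectpath_def Let_def a2_def[symmetric] a4_def[symmetric]
    by (simp add: contour_integrable_join)
qed

lemma contour_integral_linepath_horizontal_bound:
  assumes "continuous_on (closed_segment a b) h" "Im a = Im b"
    "\<And>z. Im z = Im b \<Longrightarrow> Re z \<in> closed_segment (Re a) (Re b) \<Longrightarrow> norm (h z) \<le> B"
  shows "norm (contour_integral (linepath a b) h) \<le> B * \<bar>Re b - Re a\<bar>"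
proof -
  have n: "norm (b - a) = \<bar>Re b - Re a\<bar>" using assms(2) by (simp add: cmod_def)
  have "0 \<le> B" using order_trans[OF norm_ge_zero assms(3)[of b]] by simp
  then show ?thesis
    using assms unfolding n[symmetric]
    by (intro contour_integral_bound_linepath contour_integrable_continuous_linepath)
       (auto simp: closed_segment_same_Im)
qed

lemma contour_integral_linepath_vertical_bound:
  assumes "continuous_on (closed_segment a b) h" "Re a = Re b"
    "\<And>z. Re z = Re b \<Longrightarrow> Im z \<in> closed_segment (Im a) (Im b) \<Longrightarrow> norm (h z) \<le> B"
  shows "norm (contour_integral (linepath a b) h) \<le> B * \<bar>Im b - Im a\<bar>"
proof -
  have n: "norm (b - a) = \<bar>Im b - Im a\<bar>" using assms(2) by (simp add: cmod_def)
  have "0 \<le> B" using order_trans[OF norm_ge_zero assms(3)[of b]] by simp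
  then show ?thesis
    using assms unfolding n[symmetric]
    by (intro contour_integral_bound_linepath contour_integrable_continuous_linepath)
       (auto simp: closed_segment_same_Re)
qed

text \<open>Used for contours closed to the left: the two horizontal edges of length
  \<open>r - l\<close> are controlled by \<open>B\<close>, the left edge of length
  \<open>2 * y\<close> by \<open>C\<close>.\<close>

lemma rectpath_minus_right_edge_bound:
  assumes "l \<le> r" "0 \<le> y"
    and cont: "continuous_on (path_image (rectpath (Complex l (-y)) (Complex r y))) h"
    and B: "\<And>z. l \<le> Re z \<Longrightarrow> Re z \<le> r \<Longrightarrow> \<bar>Im z\<bar> = y \<Longrightarrow> norm (h z) \<le> B"
    and C: "\<And>z. Re z = l \<Longrightarrow> \<bar>Im z\<bar> \<le> y \<Longrightarrow> norm (h z) \<le> C"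
  shows "norm (contour_integral (rectpath (Complex l (-y)) (Complex r y)) h -
               contour_integral (linepath (Complex r (-y)) (Complex r y)) h)
           \<le> 2 * B * (r - l) + 2 * C * y"
proof -
  have sub: "continuous_on (closed_segment (Complex l (-y)) (Complex r (-y))) h"
    "continuous_on (closed_segment (Complex r y) (Complex l y)) h"
    "continuous_on (closed_segment (Complex l y) (Complex l (-y))) h"
    by (rule continuous_on_subset[OF cont],
        use assms(1,2) in \<open>auto simp: path_image_rectpath closed_segment_same_Re
          closed_segment_same_Im closed_segment_eq_real_ivl\<close>)+
  have seg: "closed_segment r l = {l..r}" "closed_segment y (- y) = {- y..y}"
    "closed_segment (- y) y = {- y..y}"
    using assms(1,2) closed_segment_eq_real_ivl[of l r] closed_segment_eq_real_ivl[of "- y" y]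
    by (simp_all add: closed_segment_commute)
  have 1: "norm (contour_integral (linepath (Complex l (-y)) (Complex r (-y))) h) \<le> B * (r - l)"
    using contour_integral_linepath_horizontal_bound[OF sub(1), of B] assms(1,2) B
    by (auto simp: closed_segment_eq_real_ivl)
  have 2: "norm (contour_integral (linepath (Complex r y) (Complex l y)) h) \<le> B * (r - l)"
    using contour_integral_linepath_horizontal_bound[OF sub(2), of B] assms(1,2) B
    by (auto simp: seg)
  have 3: "norm (contour_integral (linepath (Complex l y) (Complex l (-y))) h) \<le> C * (2 * y)"
    using contour_integral_linepath_vertical_bound[OF sub(3), of C] assms(1,2) C
    by (auto simp: seg abs_le_iff)
  show ?thesis
    unfolding contour_integral_rectpath[OF cont]
    using norm_triangle_mono[OF norm_triangle_mono[OF 1 2] 3] by (simp add: algebra_simps)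
qed

text \<open>The mirror image, for contours closed to the right. The sign is a plus because the
  rectangle runs down its left edge.\<close>

lemma rectpath_plus_left_edge_bound:
  assumes "l \<le> r" "0 \<le> y"
    and cont: "continuous_on (path_image (rectpath (Complex l (-y)) (Complex r y))) h"
    and B: "\<And>z. l \<le> Re z \<Longrightarrow> Re z \<le> r \<Longrightarrow> \<bar>Im z\<bar> = y \<Longrightarrow> norm (h z) \<le> B"
    and C: "\<And>z. Re z = r \<Longrightarrow> \<bar>Im z\<bar> \<le> y \<Longrightarrow> norm (h z) \<le> C"
  shows "norm (contour_integral (rectpath (Complex l (-y)) (Complex r y)) h +
               contour_integral (linepath (Complex l (-y)) (Complex l y)) h)
           \<le> 2 * B * (r - l) + 2 * C * y"
proof -
  have sub: "continuous_on (closed_segment (Complex l (-y)) (Complex r (-y))) h"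
    "continuous_on (closed_segment (Complex r y) (Complex l y)) h"
    "continuous_on (closed_segment (Complex r (-y)) (Complex r y)) h"
    "continuous_on (closed_segment (Complex l (-y)) (Complex l y)) h"
    by (rule continuous_on_subset[OF cont],
        use assms(1,2) in \<open>auto simp: path_image_rectpath closed_segment_same_Re
          closed_segment_same_Im closed_segment_eq_real_ivl\<close>)+
  have seg: "closed_segment r l = {l..r}" "closed_segment y (- y) = {- y..y}"
    "closed_segment (- y) y = {- y..y}"
    using assms(1,2) closed_segment_eq_real_ivl[of l r] closed_segment_eq_real_ivl[of "- y" y]
    by (simp_all add: closed_segment_commute)
  have 1: "norm (contour_integral (linepath (Complex l (-y)) (Complex r (-y))) h) \<le> B * (r - l)"
    using contour_integral_linepath_horizontal_bound[OF sub(1), of B] assms(1,2) B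
    by (auto simp: closed_segment_eq_real_ivl)
  have 2: "norm (contour_integral (linepath (Complex r y) (Complex l y)) h) \<le> B * (r - l)"
    using contour_integral_linepath_horizontal_bound[OF sub(2), of B] assms(1,2) B
    by (auto simp: seg)
  have 3: "norm (contour_integral (linepath (Complex r (-y)) (Complex r y)) h) \<le> C * (2 * y)"
    using contour_integral_linepath_vertical_bound[OF sub(3), of C] assms(1,2) C
    by (auto simp: seg abs_le_iff)
  have "contour_integral (linepath (Complex l y) (Complex l (-y))) h =
      - contour_integral (linepath (Complex l (-y)) (Complex l y)) h"
    by (rule contour_integral_reverse_linepath) (use sub(4) in \<open>simp add: closed_segment_commute\<close>)
  then show ?thesis
    unfolding contour_integral_rectpath[OF cont]
    using norm_triangle_mono[OF norm_triangle_mono[OF 1 2] 3] by (simp add: algebra_simps)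
qed

text \<open>The singular set may be infinite, so the residue theorem is applied in a ball around the
  rectangle, which meets \<open>Z\<close> in a finite set. Winding numbers are 1 inside the
  rectangle and 0 outside.\<close>

lemma Residue_theorem_rectpath:
  assumes ab: "Re a < Re b" "Im a < Im b"
    and fin: "\<And>r. finite (Z \<inter> ball 0 r)"
    and holo: "h holomorphic_on - Z"
    and avoid: "Z \<inter> path_image (rectpath a b) = {}"
  shows "contour_integral (rectpath a b) h = 2 * pi * \<i> * (\<Sum>p\<in>Z \<inter> box a b. residue h p)"
proof -
  obtain R where R: "cbox a b \<subseteq> ball 0 R"
    using bounded_subset_ballD[OF bounded_cbox] by blast
  define P where "P = Z \<inter> ball 0 R"
  have img: "path_image (rectpath a b) = cbox a b - box a b"
    using ab by (intro path_image_rectpath_cbox_minus_box) auto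
  have "contour_integral (rectpath a b) h =
          2 * pi * \<i> * (\<Sum>p\<in>P. winding_number (rectpath a b) p * residue h p)"
  proof (rule Residue_theorem[of "ball 0 R"])
    show "finite P" unfolding P_def by (rule fin)
    show "h holomorphic_on ball 0 R - P"
      by (rule holomorphic_on_subset[OF holo]) (auto simp: P_def)
    show "path_image (rectpath a b) \<subseteq> ball 0 R - P"
      using avoid R by (auto simp: img P_def)
    show "\<forall>z. z \<notin> ball 0 R \<longrightarrow> winding_number (rectpath a b) z = 0"
      using R ab by (auto intro!: winding_number_rectpath_outside)
  qed auto
  also have "(\<Sum>p\<in>P. winding_number (rectpath a b) p * residue h p) =
      (\<Sum>p\<in>Z \<inter> box a b. residue h p)"
  proof (rule sum.mono_neutral_cong_right)
    show "finite P" unfolding P_def by (rule fin)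
    show "Z \<inter> box a b \<subseteq> P" using R box_subset_cbox[of a b] by (auto simp: P_def)
    show "\<forall>p\<in>P - Z \<inter> box a b. winding_number (rectpath a b) p * residue h p = 0"
    proof
      fix p assume "p \<in> P - Z \<inter> box a b"
      then have "p \<notin> cbox a b" using avoid by (auto simp: img P_def)
      then show "winding_number (rectpath a b) p * residue h p = 0"
        using ab by (simp add: winding_number_rectpath_outside)
    qed
    show "\<And>p. p \<in> Z \<inter> box a b \<Longrightarrow> winding_number (rectpath a b) p * residue h p = residue h p"
      by (simp add: winding_number_rectpath)
  qed
  finally show ?thesis .
qed

section \<open>Residues and bounds\<close>

text \<open>The function \<open>D\<close> of the overview.\<close>

definition char_fun :: "complex \<Rightarrow> complex" where
  "char_fun s = s - 1 + exp (- s)"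

lemma char_fun_eq_0_iff: "char_fun s = 0 \<longleftrightarrow> s \<in> insert 0 char_roots"
proof -
  have "char_fun s = 0 \<longleftrightarrow> s = 1 - exp (- s)"
    unfolding char_fun_def by (simp add: algebra_simps eq_iff_diff_eq_0[of s])
  then show ?thesis by (auto simp: char_roots_def)
qed

lemma holomorphic_char_fun [holomorphic_intros]: "char_fun holomorphic_on A"
  unfolding char_fun_def by (intro holomorphic_intros)

lemma continuous_on_char_fun [continuous_intros]: "continuous_on A char_fun"
  unfolding char_fun_def by (intro continuous_intros)

text \<open>A nonconstant entire function has finitely many zeros in a compact disc.\<close>

lemma finite_char_fun_zeros_ball: "finite (insert 0 char_roots \<inter> ball 0 r)"
proof -
  have "char_fun 0 = 0" "char_fun 1 = exp (- 1)" by (simp_all add: char_fun_def)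
  then have "\<not> char_fun constant_on UNIV"
    unfolding constant_on_def by (metis UNIV_I exp_not_eq_zero)
  then have "finite {z \<in> cball 0 r. char_fun z = 0}"
    by (intro holomorphic_compact_finite_zeros[of _ UNIV] holomorphic_intros) auto
  then show ?thesis
    by (rule finite_subset[rotated]) (auto simp: char_fun_eq_0_iff)
qed

text \<open>The derivative \<open>1 - exp (- s)\<close> of \<open>char_fun\<close> equals
  \<open>\<gamma>\<close> at the root \<open>\<gamma>\<close>, so the pole is simple.\<close>

lemma residue_exp_over_char_fun:
  assumes "\<gamma> \<in> char_roots"
  shows "residue (\<lambda>s. exp (s * of_real t) / char_fun s) \<gamma> = 1 / \<gamma> * exp (\<gamma> * of_real t)"
proof -
  have "(char_fun has_field_derivative \<gamma>) (at \<gamma>)"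
    unfolding char_fun_def
    by (auto intro!: derivative_eq_intros simp: char_roots_exp_minus[OF assms])
  moreover have "\<gamma> \<noteq> 0" "char_fun \<gamma> = 0"
    using assms char_roots_Re_neg[OF assms] by (auto simp: char_fun_eq_0_iff)
  ultimately have "residue (\<lambda>s. exp (s * of_real t) / char_fun s) \<gamma> = exp (\<gamma> * of_real t) / \<gamma>"
    by (intro residue_simple_pole_deriv[where s = UNIV]) (auto intro!: holomorphic_intros)
  then show ?thesis by simp
qed

text \<open>As \<open>char_fun s = s^2 / 2 - s^3 / 6 + ...\<close>, the quotient is
  \<open>Q / s^2\<close> for a power series \<open>Q\<close>, and the residue is the coefficient
  \<open>q1\<close>. It follows from \<open>q0 / 2 = 1\<close> and
  \<open>- q0 / 6 + q1 / 2 = t\<close>.\<close>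

lemma residue_exp_over_char_fun_0:
  "residue (\<lambda>s. exp (s * of_real t) / char_fun s) 0 = 2 * of_real t + 2 / 3"
proof -
  define F :: "complex fps" where "F = fps_X - 1 + fps_exp (-1)"
  define A where "A = fps_exp (complex_of_real t)"
  define E where "E = (\<lambda>s. if s = 0 then 1 / 2 else char_fun s / s ^ 2)"
  define Q where "Q = A / fps_shift 2 F"
  have nth: "fps_nth F 0 = 0" "fps_nth F 1 = 0" "fps_nth F 2 = 1 / 2" "fps_nth F 3 = - 1 / 6"
    by (simp_all add: F_def fps_exp_def fact_numeral)
  have "(\<lambda>s. s - 1 + exp (- 1 * s)) has_fps_expansion F"
    unfolding F_def by (intro fps_expansion_intros)
  then have "char_fun has_fps_expansion F" by (simp add: char_fun_def[abs_def])
  moreover have "2 \<le> subdegree F"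
  proof (rule subdegree_geI)
    show "F \<noteq> 0" using nth(3) by auto
    show "\<And>i. i < 2 \<Longrightarrow> fps_nth F i = 0" using nth by (auto simp: less_2_cases_iff)
  qed
  ultimately have "E has_fps_expansion fps_shift 2 F"
    unfolding E_def by (intro has_fps_expansion_shift) (auto simp: nth)
  moreover have "(\<lambda>s. exp (of_real t * s)) has_fps_expansion A"
    unfolding A_def by (intro fps_expansion_intros)
  ultimately have "(\<lambda>s. exp (of_real t * s) / E s) has_fps_expansion Q"
    unfolding Q_def by (intro has_fps_expansion_divide') (simp_all add: nth nth(3)[unfolded numeral_2_eq_2])
  then have "residue (\<lambda>s. exp (of_real t * s) / E s / s ^ Suc 1) 0 = fps_nth Q 1"
    by (rule residue_fps_expansion_over_power_at_0)
  \<comment> \<open>The two functions agree even at 0, where division by zero makes both equal to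
    0.\<close>
  moreover have "(\<lambda>s. exp (of_real t * s) / E s / s ^ Suc 1) =
      (\<lambda>s. exp (s * of_real t) / char_fun s)"
    by (auto simp: E_def fun_eq_iff char_fun_def mult.commute power2_eq_square)
  moreover have "fps_nth Q 1 = 2 * of_real t + 2 / 3"
  proof -
    have "Q * fps_shift 2 F = A"
      unfolding Q_def
      by (subst fps_divide_unit) (simp_all add: nth mult.assoc inverse_mult_eq_1 nth(3)[unfolded numeral_2_eq_2])
    then have "fps_nth (Q * fps_shift 2 F) 0 = fps_nth A 0"
      "fps_nth (Q * fps_shift 2 F) 1 = fps_nth A 1" by simp_all
    then have "fps_nth Q 0 * (1 / 2) = 1"
      "fps_nth Q 0 * (- 1 / 6) + fps_nth Q 1 * (1 / 2) = of_real t"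
      by (simp_all add: fps_mult_nth A_def nth nth(3,4)[unfolded numeral_2_eq_2 numeral_3_eq_3])
    then show ?thesis by (simp add: field_simps)
  qed
  ultimately show ?thesis by simp
qed

lemma higher_deriv_exp_mult:
  "(deriv ^^ n) (\<lambda>s. exp (a * s)) = (\<lambda>s. a ^ n * exp (a * s :: complex))"
proof (induction n)
  case (Suc n)
  have "deriv (\<lambda>s. a ^ n * exp (a * s)) s = a ^ Suc n * exp (a * s)" for s
    by (rule DERIV_imp_deriv) (auto intro!: derivative_eq_intros)
  then show ?case by (simp add: Suc.IH)
qed simp

text \<open>With \<open>a = t - i\<close> and \<open>n = i\<close> this is the \<open>i\<close>-th
  summand of \<open>renewal_fun t\<close> up to the sign \<open>(- 1) ^ i\<close>.\<close>

lemma residue_exp_over_power: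
  "residue (\<lambda>s. exp (a * s) / (s - 1) ^ Suc n) 1 = a ^ n * exp a / fact n"
  using residue_holomorphic_over_power[of UNIV 1 "\<lambda>s. exp (a * s)" n]
  by (simp add: higher_deriv_exp_mult holomorphic_intros)

section \<open>Lower bounds for the denominator on the edges, and the expansion of its
  reciprocal\<close>

text \<open>\<open>Im (char_fun s) = Im s - exp (- Re s) * sin (Im s)\<close>, and at
  \<open>Im s = y\<close> or \<open>- y\<close> both parts have the same sign, so nothing
  cancels.\<close>

lemma char_fun_bound_horizontal:
  assumes "sin y = - 1" "0 \<le> y" "\<bar>Im s\<bar> = y"
  shows "y + exp (- Re s) \<le> norm (char_fun s)"
proof -
  have "\<bar>Im (char_fun s)\<bar> = y + exp (- Re s)"
  proof (cases "Im s \<ge> 0")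
    case True
    then show ?thesis using assms by (simp add: char_fun_def Im_exp)
  next
    case False
    then have "Im s = - y" using assms by simp
    then have "Im (char_fun s) = - (y + exp (- Re s))"
      using assms(1) by (simp add: char_fun_def Im_exp)
    then show ?thesis using assms(2) by (simp add: add_nonneg_pos abs_of_pos del: minus_add_distrib)
  qed
  then show ?thesis by (metis abs_Im_le_cmod)
qed

text \<open>Here \<open>exp (- s)\<close> outweighs \<open>s - 1\<close>. For
  \<open>l = ln (4 * y)\<close> the last hypothesis reads
  \<open>1 + ln (4 * y) \<le> y\<close>.\<close>

lemma char_fun_bound_left:
  assumes "Re s = - l" "\<bar>Im s\<bar> \<le> y" "0 \<le> l" "1 + l + 3 * y \<le> exp l"
  shows "2 * y \<le> norm (char_fun s)"
proof -
  have "norm (exp (- s)) = exp l" using assms by simp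
  moreover have "norm (s - 1) \<le> 1 + l + y"
    using cmod_le[of "s - 1"] assms by simp
  moreover have "norm (exp (- s)) \<le> norm (char_fun s) + norm (s - 1)"
    using norm_triangle_ineq4[of "char_fun s" "s - 1"] by (simp add: char_fun_def)
  ultimately show ?thesis using assms by linarith
qed

lemma char_fun_bound_right:
  assumes "2 \<le> Re s"
  shows "norm (s - 1) / 2 \<le> norm (char_fun s)"
proof -
  have 1: "1 \<le> norm (s - 1)" using complex_Re_le_cmod[of "s - 1"] assms by simp
  have "norm (exp (- s)) \<le> exp (- 1)" using assms by simp
  also have "\<dots> \<le> 1 / 2"
    using exp_ge_add_one_self[of 1] by (simp add: exp_minus field_simps)
  finally have "norm (exp (- s)) \<le> norm (s - 1) / 2" using 1 by simp
  moreover have "norm (s - 1) \<le> norm (char_fun s) + norm (exp (- s))"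
    using norm_triangle_ineq4[of "char_fun s" "exp (- s)"] by (simp add: char_fun_def)
  ultimately show ?thesis by simp
qed

lemma inverse_char_fun_expansion:
  assumes "s \<noteq> 1" "char_fun s \<noteq> 0"
  shows "1 / char_fun s = (\<Sum>i\<le>n. (- 1) ^ i * exp (- of_nat i * s) / (s - 1) ^ Suc i) +
           (- 1) ^ Suc n * exp (- of_nat (Suc n) * s) / ((s - 1) ^ Suc n * char_fun s)"
proof -
  define q where "q = - exp (- s) / (s - 1)"
  have D: "char_fun s = (s - 1) * (1 - q)" using assms by (simp add: q_def char_fun_def field_simps)
  then have q: "1 - q \<noteq> 0" using assms by auto
  have pw: "q ^ i = (- 1) ^ i * exp (- of_nat i * s) / (s - 1) ^ i" for i
    unfolding q_def power_divide power_minus[of "exp (- s)"]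
    by (simp flip: exp_of_nat_mult)
  have "1 = (\<Sum>i\<le>n. q ^ i) * (1 - q) + q ^ Suc n"
    using one_diff_power_eq[of q "Suc n"] by (simp add: lessThan_Suc_atMost algebra_simps)
  then have "1 / char_fun s = ((\<Sum>i\<le>n. q ^ i) * (1 - q) + q ^ Suc n) / char_fun s" by simp
  also have "\<dots> = (\<Sum>i\<le>n. q ^ i) / (s - 1) + q ^ Suc n / char_fun s"
    using q assms by (simp add: add_divide_distrib D)
  also have "(\<Sum>i\<le>n. q ^ i) / (s - 1) = (\<Sum>i\<le>n. (- 1) ^ i * exp (- of_nat i * s) / (s - 1) ^ Suc i)"
    unfolding sum_divide_distrib pw by (simp add: mult.commute)
  also have "q ^ Suc n / char_fun s =
      (- 1) ^ Suc n * exp (- of_nat (Suc n) * s) / ((s - 1) ^ Suc n * char_fun s)"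
    unfolding pw by simp
  finally show ?thesis .
qed

section \<open>Integrals over vertical segments\<close>

text \<open>A truncated Laplace inversion integral without the factor \<open>1 / (2 pi i)\<close>.
  The abscissa 2 lies to the right of 0, of 1 and of all characteristic roots.\<close>

definition vertical_integral :: "real \<Rightarrow> (complex \<Rightarrow> complex) \<Rightarrow> complex" where
  "vertical_integral y h = contour_integral (linepath (Complex 2 (- y)) (Complex 2 y)) h"

text \<open>Closing to the left picks up the residue at 1. Decay on the left edge comes from the
  exponential if \<open>n = 0\<close> and from the power if \<open>n > 0\<close>. For
  \<open>a = 0\<close> and \<open>n = 0\<close> the limit would be only \<open>pi * i\<close>, half
  of the residue term.\<close>

lemma tendsto_vertical_integral_exp_over_power:
  fixes a :: real
  assumes "a \<ge> 0" "a > 0 \<or> n > 0"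
  shows "((\<lambda>y. vertical_integral y (\<lambda>s. exp (of_real a * s) / (s - 1) ^ Suc n)) \<longlongrightarrow>
            2 * pi * \<i> * (of_real a ^ n * exp (of_real a) / fact n)) at_top"
proof -
  define h where "h = (\<lambda>s. exp (complex_of_real a * s) / (s - 1) ^ Suc n)"
  define I where "I = 2 * pi * \<i> * (of_real a ^ n * exp (complex_of_real a) / fact n)"
  \<comment> \<open>The left edge must be far enough out that \<open>y / M\<^sup>2\<close> vanishes (for \<open>n > 0\<close>), yet
    \<open>M / y\<close> has to vanish on the horizontal edges (for \<open>n = 0\<close>).\<close>
  define M where "M = (\<lambda>y::real. y powr (3 / 4))"
  define C where "C = (\<lambda>y. if n = 0 then exp (- a * M y) else 1 / M y ^ 2)"
  define bd where "bd = (\<lambda>y. 2 * (exp (2 * a) / y) * (2 - (- M y)) + 2 * C y * y)"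
  have "((\<lambda>y. I - vertical_integral y h) \<longlongrightarrow> 0) at_top"
  proof (rule Lim_null_comparison)
    show "(bd \<longlongrightarrow> 0) at_top"
    proof (cases "n = 0")
      case True
      then have "a > 0" using assms by auto
      then show ?thesis unfolding bd_def C_def M_def using True by simp real_asymp
    next
      case False
      then show ?thesis unfolding bd_def C_def M_def by simp real_asymp
    qed
    show "\<forall>\<^sub>F y in at_top. norm (I - vertical_integral y h) \<le> bd y"
      using eventually_ge_at_top[of "2::real"]
    proof eventually_elim
      case (elim y)
      define R where "R = rectpath (Complex (- M y) (- y)) (Complex 2 y)"
      have M: "M y \<ge> 1" using elim by (simp add: M_def ge_one_powr_ge_zero)
      have img: "z \<noteq> 1" if "z \<in> path_image R" for z
        using that M elim by (auto simp: R_def path_image_rectpath)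
      have h: "h holomorphic_on - {1}" unfolding h_def by (intro holomorphic_intros) auto
      have "contour_integral R h = 2 * pi * \<i> * (\<Sum>p\<in>{1} \<inter> box (Complex (- M y) (- y)) (Complex 2 y). residue h p)"
        unfolding R_def
        by (rule Residue_theorem_rectpath) (use M elim h img in \<open>auto simp: R_def\<close>)
      also have "{1} \<inter> box (Complex (- M y) (- y)) (Complex 2 y) = {1::complex}"
        using M elim by (auto simp: in_box_complex_iff)
      also have "2 * pi * \<i> * (\<Sum>p\<in>{1}. residue h p) = I"
        by (simp add: h_def I_def residue_exp_over_power del: power_Suc)
      finally have I: "contour_integral R h = I" .
      have nrm: "norm (h z) = exp (a * Re z) / norm (z - 1) ^ Suc n" for z
        by (simp add: h_def norm_divide norm_mult norm_power)
      have "norm (contour_integral R h - vertical_integral y h) \<le> bd y"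
        unfolding R_def vertical_integral_def bd_def
      proof (rule rectpath_minus_right_edge_bound)
        show "continuous_on (path_image (rectpath (Complex (- M y) (- y)) (Complex 2 y))) h"
          by (rule continuous_on_subset[OF holomorphic_on_imp_continuous_on[OF h]])
             (use img in \<open>auto simp: R_def\<close>)
        show "norm (h z) \<le> exp (2 * a) / y" if "Re z \<le> 2" "\<bar>Im z\<bar> = y" for z
        proof -
          have "y \<le> norm (z - 1)" using abs_Im_le_cmod[of "z - 1"] that by simp
          then have "y \<le> norm (z - 1) ^ Suc n"
            using elim self_le_power[of "norm (z - 1)" "Suc n"] by linarith
          moreover have "a * Re z \<le> 2 * a" using that assms mult_left_mono[of "Re z" 2 a] by (simp add: mult.commute)
          ultimately show ?thesis unfolding nrm using elim by (intro frac_le) auto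
        qed
        show "norm (h z) \<le> C y" if "Re z = - M y" for z
        proof -
          have 1: "M y \<le> norm (z - 1)" using abs_Re_le_cmod[of "z - 1"] that M by simp
          show ?thesis
          proof (cases "n = 0")
            case True
            then show ?thesis unfolding nrm C_def using 1 M that
                frac_le[of "exp (- (a * M y))" "exp (- (a * M y))" 1 "norm (z - 1)"] by simp
          next
            case False
            have "M y ^ 2 \<le> M y ^ Suc n" using M False by (intro power_increasing) auto
            also have "\<dots> \<le> norm (z - 1) ^ Suc n" using 1 M by (intro power_mono) auto
            finally have 2: "M y ^ 2 \<le> norm (z - 1) ^ Suc n" .
            have "exp (a * Re z) \<le> 1" using that M assms by simp
            then show ?thesis unfolding nrm C_def using 2 M False
              by (auto intro!: frac_le simp del: power_Suc)
          qed
        qed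
      qed (use M elim in auto)
      then show ?case unfolding I .
    qed
  qed
  then have "((\<lambda>y. I - (I - vertical_integral y h)) \<longlongrightarrow> I - 0) at_top"
    by (intro tendsto_intros)
  then show ?thesis by (simp add: h_def I_def)
qed

text \<open>Closing to the right as far as \<open>Re s = y\<close> meets no pole. The exponential is
  at most 1 there and the denominator at least \<open>|s - 1|^2 / 2\<close>, which beats edges of
  length of order \<open>y\<close>.\<close>

lemma tendsto_vertical_integral_remainder:
  fixes b :: real
  assumes "b \<ge> 0"
  shows "((\<lambda>y. vertical_integral y (\<lambda>s. exp (- of_real b * s) / ((s - 1) ^ Suc n * char_fun s)))
            \<longlongrightarrow> 0) at_top"
proof -
  define h where "h = (\<lambda>s. exp (- complex_of_real b * s) / ((s - 1) ^ Suc n * char_fun s))"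
  define bd where "bd = (\<lambda>y::real. 2 * (1 / (y * (y / 2))) * (y - 2) + 2 * (1 / ((y - 1) * ((y - 1) / 2))) * y)"
  have "((\<lambda>y. vertical_integral y h) \<longlongrightarrow> 0) at_top"
  proof (rule Lim_null_comparison)
    show "(bd \<longlongrightarrow> 0) at_top" unfolding bd_def by real_asymp
    show "\<forall>\<^sub>F y in at_top. norm (vertical_integral y h) \<le> bd y"
      using eventually_ge_at_top[of "3::real"]
    proof eventually_elim
      case (elim y)
      define Z where "Z = insert 1 (insert 0 char_roots)"
      define R where "R = rectpath (Complex 2 (- y)) (Complex y y)"
      have Z: "Re z < 2" if "z \<in> Z" for z
        using that char_roots_Re_neg[of z] by (auto simp: Z_def)
      have img: "z \<notin> Z" if "z \<in> path_image R" for z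
        using that elim Z by (force simp: R_def path_image_rectpath)
      have h: "h holomorphic_on - Z"
        unfolding h_def by (intro holomorphic_intros) (auto simp: Z_def char_fun_eq_0_iff)
      have "contour_integral R h = 2 * pi * \<i> * (\<Sum>p\<in>Z \<inter> box (Complex 2 (- y)) (Complex y y). residue h p)"
        unfolding R_def
      proof (rule Residue_theorem_rectpath)
        have "finite (insert 1 (insert 0 char_roots \<inter> ball 0 r))" for r
          using finite_char_fun_zeros_ball by blast
        then show "finite (Z \<inter> ball 0 r)" for r
          by (rule finite_subset[rotated]) (auto simp: Z_def)
      qed (use elim h img in \<open>auto simp: R_def\<close>)
      also have "Z \<inter> box (Complex 2 (- y)) (Complex y y) = {}"
        using Z by (force simp: in_box_complex_iff)
      finally have I: "contour_integral R h = 0" by simp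
      have bound: "norm (h z) \<le> 1 / (c * (c / 2))"
        if "2 \<le> Re z" "1 \<le> c" "c \<le> norm (z - 1)" for c z
      proof -
        have "c \<le> norm (z - 1) ^ Suc n"
          using that self_le_power[of "norm (z - 1)" "Suc n"] by linarith
        moreover have "c / 2 \<le> norm (char_fun z)" using char_fun_bound_right[of z] that by simp
        ultimately have "c * (c / 2) \<le> norm (z - 1) ^ Suc n * norm (char_fun z)"
          using that by (intro mult_mono) auto
        moreover have "exp (- b * Re z) \<le> 1" using that assms by simp
        moreover have "norm (h z) = exp (- b * Re z) / (norm (z - 1) ^ Suc n * norm (char_fun z))"
          by (simp add: h_def norm_divide norm_mult norm_power)
        ultimately show ?thesis using that by (simp only:) (intro frac_le; simp)
      qed
      have "norm (contour_integral R h + vertical_integral y h) \<le> bd y"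
        unfolding R_def vertical_integral_def bd_def
      proof (rule rectpath_plus_left_edge_bound)
        show "continuous_on (path_image (rectpath (Complex 2 (- y)) (Complex y y))) h"
          by (rule continuous_on_subset[OF holomorphic_on_imp_continuous_on[OF h]])
             (use img in \<open>auto simp: R_def\<close>)
        show "norm (h z) \<le> 1 / (y * (y / 2))" if "2 \<le> Re z" "\<bar>Im z\<bar> = y" for z
          using that elim abs_Im_le_cmod[of "z - 1"] by (intro bound) auto
        show "norm (h z) \<le> 1 / ((y - 1) * ((y - 1) / 2))" if "Re z = y" for z
          using that elim abs_Re_le_cmod[of "z - 1"] by (intro bound) auto
      qed (use elim in auto)
      then show ?case unfolding I by simp
    qed
  qed
  then show ?thesis by (simp add: h_def)
qed

section \<open>The residue sum and the renewal function as limits of one vertical integral\<close>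

text \<open>Closing to the left at \<open>Re s = - ln (4 * y)\<close>, where
  \<open>|exp (s * t)| = (4 * y) powr (- t)\<close>. The two error terms come from the horizontal
  edges and from the left edge.\<close>

lemma renewal_residue_sum_bound:
  fixes t y :: real
  assumes t: "t > 0" and y: "y \<ge> 1" "1 + ln (4 * y) \<le> y" "sin y = - 1"
  shows "norm (2 * pi * \<i> * (2 * of_real t + 2 / 3 +
             (\<Sum>\<gamma>\<in>char_roots \<inter> box (Complex (- ln (4 * y)) (- y)) (Complex 2 y).
                1 / \<gamma> * exp (\<gamma> * of_real t)))
           - vertical_integral y (\<lambda>s. exp (s * of_real t) / char_fun s))
         \<le> 2 * (exp (2 * t) / y) * (2 - (- ln (4 * y))) + 2 * ((4 * y) powr (- t) / (2 * y)) * y"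
proof -
  define h where "h = (\<lambda>s. exp (s * complex_of_real t) / char_fun s)"
  define l where "l = ln (4 * y)"
  define Z where "Z = insert 0 char_roots"
  define R where "R = rectpath (Complex (- l) (- y)) (Complex 2 y)"
  define B where "B = box (Complex (- l) (- y)) (Complex 2 y)"
  have l: "l > 0" "exp l = 4 * y" using y by (auto simp: l_def)
  have left: "2 * y \<le> norm (char_fun z)" if "Re z = - l" "\<bar>Im z\<bar> \<le> y" for z
    using that l y by (intro char_fun_bound_left) (auto simp: l_def)
  have top: "y \<le> norm (char_fun z)" if "\<bar>Im z\<bar> = y" for z
    using char_fun_bound_horizontal[OF y(3), of z] that y exp_gt_zero[of "- Re z"] by linarith
  have img: "z \<notin> Z" if "z \<in> path_image R" for z
  proof -
    \<comment> \<open>No pole lies on the contour: on the right edge \<open>Re z\<close> is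
      positive, on the others the lower bounds exclude zeros of \<open>char_fun\<close>.\<close>
    consider "Re z = - l" "\<bar>Im z\<bar> \<le> y" | "Re z = 2" | "\<bar>Im z\<bar> = y"
      using \<open>z \<in> path_image R\<close> l y unfolding R_def by (subst (asm) path_image_rectpath) auto
    then show ?thesis
    proof cases
      case 2
      then show ?thesis using char_roots_Re_neg[of z] by (auto simp: Z_def)
    qed (use left[of z] top[of z] y char_fun_eq_0_iff[of z] in \<open>auto simp: Z_def\<close>)
  qed
  have h: "h holomorphic_on - Z"
    unfolding h_def by (intro holomorphic_intros) (auto simp: Z_def char_fun_eq_0_iff)
  have "contour_integral R h = 2 * pi * \<i> * (\<Sum>p\<in>Z \<inter> B. residue h p)"
    unfolding R_def B_def
    by (rule Residue_theorem_rectpath)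
       (use l y h img finite_char_fun_zeros_ball in \<open>auto simp: R_def Z_def\<close>)
  also have "Z \<inter> B = insert 0 (char_roots \<inter> B)"
    using l y by (auto simp: Z_def B_def in_box_complex_iff)
  also have "(\<Sum>p\<in>insert 0 (char_roots \<inter> B). residue h p) =
      residue h 0 + (\<Sum>p\<in>char_roots \<inter> B. residue h p)"
  proof (rule sum.insert)
    obtain r where "B \<subseteq> ball 0 r"
      using bounded_subset_ballD[OF bounded_box] unfolding B_def by blast
    then show "finite (char_roots \<inter> B)"
      by (intro finite_subset[OF _ finite_char_fun_zeros_ball[of r]]) auto
    show "0 \<notin> char_roots \<inter> B" by (simp add: char_roots_def)
  qed
  also have "residue h 0 = 2 * of_real t + 2 / 3"
    unfolding h_def by (rule residue_exp_over_char_fun_0)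
  also have "(\<Sum>p\<in>char_roots \<inter> B. residue h p) = (\<Sum>\<gamma>\<in>char_roots \<inter> B. 1 / \<gamma> * exp (\<gamma> * of_real t))"
    unfolding h_def by (intro sum.cong residue_exp_over_char_fun) auto
  finally have I: "contour_integral R h = 2 * pi * \<i> * (2 * of_real t + 2 / 3 +
      (\<Sum>\<gamma>\<in>char_roots \<inter> B. 1 / \<gamma> * exp (\<gamma> * of_real t)))" .
  have nrm: "norm (h z) = exp (Re z * t) / norm (char_fun z)" for z
    by (simp add: h_def norm_divide)
  have "norm (contour_integral R h - vertical_integral y h)
      \<le> 2 * (exp (2 * t) / y) * (2 - (- l)) + 2 * ((4 * y) powr (- t) / (2 * y)) * y"
    unfolding R_def vertical_integral_def
  proof (rule rectpath_minus_right_edge_bound)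
    show "continuous_on (path_image (rectpath (Complex (- l) (- y)) (Complex 2 y))) h"
      by (rule continuous_on_subset[OF holomorphic_on_imp_continuous_on[OF h]])
         (use img in \<open>auto simp: R_def\<close>)
    show "norm (h z) \<le> exp (2 * t) / y" if "Re z \<le> 2" "\<bar>Im z\<bar> = y" for z
      unfolding nrm using that top[of z] t y by (intro frac_le) auto
    show "norm (h z) \<le> (4 * y) powr (- t) / (2 * y)" if "Re z = - l" "\<bar>Im z\<bar> \<le> y" for z
      unfolding nrm using that left[of z] t y
      by (intro frac_le) (auto simp: powr_def l_def)
  qed (use l y in auto)
  then show ?thesis unfolding I by (simp add: h_def l_def B_def)
qed

lemma renewal_fun_eq_sum_residues:
  "complex_of_real (renewal_fun t) =
    (\<Sum>i\<le>nat \<lfloor>t\<rfloor>. (- 1) ^ i * (of_real (t - real i) ^ i * exp (of_real (t - real i)) / fact i))"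
proof -
  have "(real i - t) ^ i = (- 1) ^ i * (t - real i) ^ i" for i
    by (metis minus_diff_eq power_minus)
  then have "renewal_fun t = (\<Sum>i\<le>nat \<lfloor>t\<rfloor>. (- 1) ^ i * ((t - real i) ^ i * exp (t - real i) / fact i))"
    by (simp add: renewal_fun_def atLeast0AtMost mult.assoc)
  moreover have "complex_of_real ((- 1) ^ i * (c ^ i * exp c / fact i)) =
      (- 1) ^ i * (of_real c ^ i * exp (of_real c) / fact i)" for i c
    by (simp add: exp_of_real)
  ultimately show ?thesis by (simp only: of_real_sum)
qed

lemma tendsto_vertical_integral_renewal:
  assumes "t > 0"
  shows "((\<lambda>y. vertical_integral y (\<lambda>s. exp (s * of_real t) / char_fun s)) \<longlongrightarrow>
            2 * pi * \<i> * of_real (renewal_fun t)) at_top"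
proof -
  \<comment> \<open>This cut-off gives \<open>t - i \<ge> 0\<close> for \<open>i \<le> n\<close> and
    \<open>n + 1 - t \<ge> 0\<close>, so the main terms can be closed to the left and the remainder
    to the right.\<close>
  define n where "n = nat \<lfloor>t\<rfloor>"
  define T where "T = (\<lambda>i s. exp (complex_of_real (t - real i) * s) / (s - 1) ^ Suc i)"
  define b where "b = real (Suc n) - t"
  define r where "r = (\<lambda>s. exp (- complex_of_real b * s) / ((s - 1) ^ Suc n * char_fun s))"
  have b: "b \<ge> 0" unfolding b_def n_def using assms by linarith
  have le: "real i \<le> t" if "i \<le> n" for i
    using that assms unfolding n_def by (simp add: le_nat_floor le_nat_iff le_floor_iff)
  have split: "vertical_integral y (\<lambda>s. exp (s * of_real t) / char_fun s) =
      (\<Sum>i\<le>n. (- 1) ^ i * vertical_integral y (T i)) + (- 1) ^ Suc n * vertical_integral y r" for y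
  proof -
    define g where "g = linepath (Complex 2 (- y)) (Complex 2 y)"
    have ne: "s \<noteq> 1" "char_fun s \<noteq> 0" if "Re s = 2" for s
      using that char_roots_Re_neg[of s] by (auto simp: char_fun_eq_0_iff)
    have img: "Re s = 2" if "s \<in> closed_segment (Complex 2 (- y)) (Complex 2 y)" for s
      using that by (auto simp: closed_segment_same_Re)
    have iT: "T i contour_integrable_on g" for i
      unfolding g_def T_def
      by (intro contour_integrable_continuous_linepath continuous_intros) (use ne[OF img] in auto)
    have ir: "r contour_integrable_on g"
      unfolding g_def r_def
      by (intro contour_integrable_continuous_linepath continuous_intros) (use ne[OF img] in auto)
    have "contour_integral g (\<lambda>s. exp (s * of_real t) / char_fun s) =
        contour_integral g (\<lambda>s. (\<Sum>i\<le>n. (- 1) ^ i * T i s) + (- 1) ^ Suc n * r s)"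
    proof (rule contour_integral_eq)
      fix s assume "s \<in> path_image g"
      then have "Re s = 2" using img by (simp add: g_def)
      note ne = ne[OF this]
      have e: "exp (s * of_real t) * ((- 1) ^ i * exp (- of_nat i * s) / c) =
          (- 1) ^ i * (exp (of_real (t - real i) * s) / c)" for i c
        by (simp add: mult_exp_exp algebra_simps)
      have "exp (s * of_real t) / char_fun s = exp (s * of_real t) * (1 / char_fun s)" by simp
      also have "\<dots> = (\<Sum>i\<le>n. (- 1) ^ i * T i s) + (- 1) ^ Suc n * r s"
        unfolding inverse_char_fun_expansion[OF ne, of n] distrib_left sum_distrib_left e
        by (simp add: T_def r_def b_def)
      finally show "exp (s * of_real t) / char_fun s = \<dots>" .
    qed
    also have "\<dots> = (\<Sum>i\<le>n. (- 1) ^ i * contour_integral g (T i)) + (- 1) ^ Suc n * contour_integral g r"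
      by (simp add: contour_integral_add contour_integral_sum contour_integral_lmul
          contour_integrable_sum contour_integrable_lmul iT ir del: power_Suc)
    finally show ?thesis by (simp add: vertical_integral_def g_def)
  qed
  \<comment> \<open>The excluded case \<open>a = 0\<close>, \<open>n = 0\<close> of the power
    integrals does not arise: at \<open>i = 0\<close> the exponent is \<open>t > 0\<close>.\<close>
  have "((\<lambda>y. (\<Sum>i\<le>n. (- 1) ^ i * vertical_integral y (T i)) + (- 1) ^ Suc n * vertical_integral y r)
     \<longlongrightarrow> (\<Sum>i\<le>n. (- 1) ^ i * (2 * pi * \<i> * (of_real (t - real i) ^ i * exp (of_real (t - real i)) / fact i)))
        + (- 1) ^ Suc n * 0) at_top"
    unfolding T_def r_def
    by (intro tendsto_intros tendsto_vertical_integral_exp_over_power tendsto_vertical_integral_remainder)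
       (use le b assms in auto)
  then show ?thesis
    unfolding split using assms
    by (simp add: renewal_fun_eq_sum_residues n_def sum_distrib_left mult_ac)
qed

text \<open>Along the heights \<open>Y k\<close>, where the sine is -1, the vertical integral tends
  to the renewal function and differs from the finite residue sum by a vanishing error.\<close>

lemma renewal_fun_eq_infsum:
  assumes t: "t > 0"
  shows "complex_of_real (renewal_fun t) = 2 * complex_of_real t + 2 / 3 +
           (\<Sum>\<^sub>\<infinity>\<gamma>\<in>char_roots. 1 / \<gamma> * exp (\<gamma> * complex_of_real t))"
proof -
  define e where "e = (\<lambda>\<gamma>. 1 / \<gamma> * exp (\<gamma> * complex_of_real t))"
  define Y where "Y = (\<lambda>k. 2 * real k * pi + 3 / 2 * pi)"
  define X where "X = (\<lambda>y. char_roots \<inter> box (Complex (- ln (4 * y)) (- y)) (Complex 2 y))"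
  define V where "V = (\<lambda>y. vertical_integral y (\<lambda>s. exp (s * of_real t) / char_fun s))"
  define bd where "bd = (\<lambda>y. 2 * (exp (2 * t) / y) * (2 - (- ln (4 * y))) +
      2 * ((4 * y) powr (- t) / (2 * y)) * y)"
  have Y: "filterlim Y at_top sequentially" unfolding Y_def by real_asymp
  have sinY: "sin (Y k) = - 1" for k
    unfolding Y_def sin_add sin_2npi cos_2npi sin_3over2_pi by simp
  have "(\<lambda>k. 2 * pi * \<i> * (2 * of_real t + 2 / 3 + sum e (X (Y k))) - V (Y k)) \<longlonglongrightarrow> 0"
  proof (rule Lim_null_comparison)
    have "((\<lambda>y. 2 * (exp (2 * t) / y) * (2 - (- ln (4 * y)))) \<longlongrightarrow> 0) at_top" by real_asymp
    \<comment> \<open>The left edge contributes exactly this power for \<open>y > 0\<close>; its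
      decay rests on \<open>t > 0\<close>.\<close>
    moreover have "((\<lambda>y. (4 * y) powr (- t)) \<longlongrightarrow> 0) at_top"
      using t by (intro tendsto_neg_powr) (auto, real_asymp)
    then have "((\<lambda>y. 2 * ((4 * y) powr (- t) / (2 * y)) * y) \<longlongrightarrow> 0) at_top"
      by (rule Lim_transform_eventually)
         (use eventually_gt_at_top[of 0] in \<open>eventually_elim, simp\<close>)
    ultimately have "(bd \<longlongrightarrow> 0) at_top"
      unfolding bd_def using tendsto_add_zero by blast
    then show "(\<lambda>k. bd (Y k)) \<longlonglongrightarrow> 0" using Y by (rule filterlim_compose)
    have "\<forall>\<^sub>F y::real in at_top. 1 + ln (4 * y) \<le> y" by real_asymp
    then have "\<forall>\<^sub>F k in sequentially. 1 \<le> Y k \<and> 1 + ln (4 * Y k) \<le> Y k"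
      by (intro eventually_compose_filterlim[OF _ Y] eventually_conj eventually_ge_at_top)
    then show "\<forall>\<^sub>F k in sequentially.
        norm (2 * pi * \<i> * (2 * of_real t + 2 / 3 + sum e (X (Y k))) - V (Y k)) \<le> bd (Y k)"
      by eventually_elim
         (use renewal_residue_sum_bound[OF t _ _ sinY] in \<open>simp add: V_def X_def e_def bd_def\<close>)
  qed
  moreover have "(\<lambda>k. V (Y k)) \<longlonglongrightarrow> 2 * pi * \<i> * of_real (renewal_fun t)"
    using filterlim_compose[OF tendsto_vertical_integral_renewal[OF t] Y] by (simp add: V_def)
  ultimately have "(\<lambda>k. (2 * pi * \<i> * (2 * of_real t + 2 / 3 + sum e (X (Y k))) - V (Y k)) + V (Y k))
      \<longlonglongrightarrow> 0 + 2 * pi * \<i> * of_real (renewal_fun t)"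
    by (rule tendsto_add)
  then have "(\<lambda>k. 2 * pi * \<i> * (2 * of_real t + 2 / 3 + sum e (X (Y k))) / (2 * pi * \<i>))
      \<longlonglongrightarrow> 2 * pi * \<i> * of_real (renewal_fun t) / (2 * pi * \<i>)"
    by (intro tendsto_divide tendsto_const) auto
  then have lim: "(\<lambda>k. 2 * of_real t + 2 / 3 + sum e (X (Y k))) \<longlonglongrightarrow> of_real (renewal_fun t)"
    by simp
  have "e summable_on char_roots"
    using char_roots_summable[OF t] unfolding e_def by (rule abs_summable_summable)
  then have "(sum e \<longlongrightarrow> infsum e char_roots) (finite_subsets_at_top char_roots)"
    by (rule infsum_tendsto)
  \<comment> \<open>The growing boxes eventually contain each finite set of roots, so sums over them
    converge to the unordered sum.\<close>
  moreover have "filterlim (\<lambda>k. X (Y k)) (finite_subsets_at_top char_roots) sequentially"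
    unfolding filterlim_finite_subsets_at_top
  proof (intro allI impI)
    fix A assume A: "finite A \<and> A \<subseteq> char_roots"
    have "\<forall>\<^sub>F y in at_top. \<gamma> \<in> box (Complex (- ln (4 * y)) (- y)) (Complex 2 y)" if "\<gamma> \<in> A" for \<gamma>
    proof -
      have "filterlim (\<lambda>y::real. ln (4 * y)) at_top at_top" by real_asymp
      then have "\<forall>\<^sub>F y in at_top. - Re \<gamma> < ln (4 * y)" by (simp add: filterlim_at_top_dense)
      moreover have "\<forall>\<^sub>F y in at_top. \<bar>Im \<gamma>\<bar> < y" by (rule eventually_gt_at_top)
      ultimately show ?thesis
        by eventually_elim (use A that char_roots_Re_neg[of \<gamma>] in \<open>auto simp: in_box_complex_iff\<close>)
    qed
    then have "\<forall>\<^sub>F y in at_top. \<forall>\<gamma>\<in>A. \<gamma> \<in> box (Complex (- ln (4 * y)) (- y)) (Complex 2 y)"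
      using A by (intro eventually_ball_finite) auto
    then have "\<forall>\<^sub>F k in sequentially. \<forall>\<gamma>\<in>A. \<gamma> \<in> box (Complex (- ln (4 * Y k)) (- Y k)) (Complex 2 (Y k))"
      by (rule eventually_compose_filterlim[OF _ Y])
    moreover have "finite (X y)" for y
    proof -
      obtain r where "box (Complex (- ln (4 * y)) (- y)) (Complex 2 y) \<subseteq> ball 0 r"
        using bounded_subset_ballD[OF bounded_box] by blast
      then show ?thesis
        unfolding X_def by (intro finite_subset[OF _ finite_char_fun_zeros_ball[of r]]) auto
    qed
    ultimately show "\<forall>\<^sub>F k in sequentially. finite (X (Y k)) \<and> A \<subseteq> X (Y k) \<and> X (Y k) \<subseteq> char_roots"
      by (auto simp: X_def elim!: eventually_mono dest: subsetD[OF conjunct2[OF A]])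
  qed
  ultimately have "(\<lambda>k. sum e (X (Y k))) \<longlonglongrightarrow> infsum e char_roots"
    by (rule filterlim_compose)
  then have "(\<lambda>k. 2 * of_real t + 2 / 3 + sum e (X (Y k))) \<longlonglongrightarrow> 2 * of_real t + 2 / 3 + infsum e char_roots"
    by (intro tendsto_intros)
  with lim show ?thesis unfolding e_def by (rule LIMSEQ_unique)
qed

theorem lemma4p5:
  shows "(\<forall>t::real. t > 0 \<longrightarrow>
           (\<lambda>\<gamma>. norm (1 / \<gamma> * exp (\<gamma> * complex_of_real t))) summable_on char_roots \<and>
           complex_of_real (renewal_fun t) =
             2 * complex_of_real t + 2 / 3 +
             (\<Sum>\<^sub>\<infinity>\<gamma>\<in>char_roots. 1 / \<gamma> * exp (\<gamma> * complex_of_real t))) \<and>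
         (\<forall>\<epsilon>::real. \<epsilon> > 0 \<longrightarrow>
           uniform_limit {\<epsilon><..}
             (\<lambda>F t. \<Sum>\<gamma>\<in>F. norm (1 / \<gamma> * exp (\<gamma> * complex_of_real t)))
             (\<lambda>t. \<Sum>\<^sub>\<infinity>\<gamma>\<in>char_roots. norm (1 / \<gamma> * exp (\<gamma> * complex_of_real t)))
             (finite_subsets_at_top char_roots))"
  using char_roots_summable renewal_fun_eq_infsum char_roots_uniform_limit by blast

end
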